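(* Let $G$ be a finite Dedekind group and $A$ a finite set of size $q \geq 2$. Let $r:=r(G)$ and $r_i := r_i(G)$. Let $p_1, \dots, p_s$ be the (distinct) prime divisors of $|G|$ and define $r_P :=\sum_{i=1}^s r_{p_i}$. Then \[ \mathrm{Rank}(\mathrm{ICA}(G;A)) \leq \begin{cases} (r - r_P - 1)\, \mathrm{Rank}(G) + 2 r - r_2 - 1 & \text{ if } q=2, \\ (r - r_P - 1)\, \mathrm{Rank}(G) + 2 r & \text{ if } q \geq 3. \end{cases} \]
   Context: A Dedekind group is a group in which every subgroup is normal. For a finite group $G$, $r(G)$ is the total number of conjugacy classes of subgroups of $G$, and $r_i(G)$ is the number of conjugacy classes of subgroups $H\leq G$ with index $[G:H]=i$. For a group $G$ and a finite set $A$, $A^G$ is the set of all functions $x : G \to A$, with the shift action $(g\cdot x)(h) = x(g^{-1}h)$. A cellular automaton over $A^G$ is a map $\tau : A^G \to A^G$ for which there exist a finite subset $S \subseteq G$ and a function $\mu : A^S \to A$ such that $\tau(x)(g) = \mu((g^{-1}\cdot x)|_S)$ for all $x \in A^G$, $g\in G$. $\mathrm{CA}(G;A)$ is the monoid of all cellular automata over $A^G$ under composition, and $\mathrm{ICA}(G;A)$ is its group of units. For a monoid $M$, $\mathrm{Rank}(M)$ is the minimal cardinality of a subset $T \subseteq M$ generating $M$ as a monoid. *)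

theory Defs
  imports "HOL-Algebra.Algebra"
begin

definition dedekind_group :: "('g, 'm) monoid_scheme \<Rightarrow> bool"
  where "dedekind_group G \<longleftrightarrow> group G \<and> (\<forall>H. subgroup H G \<longrightarrow> H \<lhd> G)"


definition subgroup_conj :: "('g, 'm) monoid_scheme \<Rightarrow> 'g \<Rightarrow> 'g set \<Rightarrow> 'g set"
  where "subgroup_conj G = (\<lambda>g H. g <#\<^bsub>G\<^esub> H #>\<^bsub>G\<^esub> (inv\<^bsub>G\<^esub> g))"

definition subgroup_classes :: "('g, 'm) monoid_scheme \<Rightarrow> nat"
  where "subgroup_classes G = card (orbits G {H. subgroup H G} (subgroup_conj G))"

(* Intended for finite G, where the index of H is the number of its cosets. *)
definition subgroup_classes_index :: "('g, 'm) monoid_scheme \<Rightarrow> nat \<Rightarrow> nat"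
  where "subgroup_classes_index G i =
    card (orbits G {H. subgroup H G \<and> card (rcosets\<^bsub>G\<^esub> H) = i} (subgroup_conj G))"


(* Maps out of a carrier set are represented by extensional functions: the set of maps X \<rightarrow> Y
   is X \<rightarrow>\<^sub>E Y, so that each map has exactly one representative. *)

definition configs :: "('g, 'm) monoid_scheme \<Rightarrow> 'a set \<Rightarrow> ('g \<Rightarrow> 'a) set"
  where "configs G A = carrier G \<rightarrow>\<^sub>E A"

definition shift :: "('g, 'm) monoid_scheme \<Rightarrow> 'g \<Rightarrow> ('g \<Rightarrow> 'a) \<Rightarrow> ('g \<Rightarrow> 'a)"
  where "shift G g x = (\<lambda>h\<in>carrier G. x (inv\<^bsub>G\<^esub> g \<otimes>\<^bsub>G\<^esub> h))"

definition cellular_automaton ::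
    "('g, 'm) monoid_scheme \<Rightarrow> 'a set \<Rightarrow> (('g \<Rightarrow> 'a) \<Rightarrow> ('g \<Rightarrow> 'a)) \<Rightarrow> bool"
  where "cellular_automaton G A \<tau> \<longleftrightarrow>
    \<tau> \<in> configs G A \<rightarrow>\<^sub>E configs G A \<and>
    (\<exists>S \<mu>. finite S \<and> S \<subseteq> carrier G \<and> \<mu> \<in> (S \<rightarrow>\<^sub>E A) \<rightarrow> A \<and>
      (\<forall>x\<in>configs G A. \<forall>g\<in>carrier G.
        \<tau> x g = \<mu> (restrict (shift G (inv\<^bsub>G\<^esub> g) x) S)))"

definition CA :: "('g, 'm) monoid_scheme \<Rightarrow> 'a set \<Rightarrow> (('g \<Rightarrow> 'a) \<Rightarrow> ('g \<Rightarrow> 'a)) monoid"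
  where "CA G A =
    \<lparr>carrier = {\<tau>. cellular_automaton G A \<tau>},
     monoid.mult = (\<lambda>\<sigma> \<tau>. compose (configs G A) \<sigma> \<tau>),
     one = (\<lambda>x\<in>configs G A. x)\<rparr>"

definition ICA :: "('g, 'm) monoid_scheme \<Rightarrow> 'a set \<Rightarrow> (('g \<Rightarrow> 'a) \<Rightarrow> ('g \<Rightarrow> 'a)) monoid"
  where "ICA G A = units_of (CA G A)"


(* The hull is the least submonoid containing T.  The value is meaningful only if M is finitely
   generated, in particular for every finite monoid M. *)
definition Rank :: "('a, 'm) monoid_scheme \<Rightarrow> nat"
  where "Rank M = (LEAST n. \<exists>T. T \<subseteq> carrier M \<and> finite T \<and> card T = n \<and>
    (\<lambda>N. submonoid N M) hull T = carrier M)"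

end

theory Submission
  imports Defs
begin

text \<open>Invertible cellular automata over \<open>G\<close> are the automorphisms of the finite \<open>G\<close>-set of
  configurations.  Since every subgroup of \<open>G\<close> is normal, all points of an orbit have the same
  stabilizer, and the automorphism group is the product, over the subgroups \<open>H\<close>, of the wreath
  products of \<open>G/H\<close> with the symmetric group on the orbits with stabilizer \<open>H\<close>.  Such a factor
  is generated by a transposition of two orbits, a full cycle twisted by one element of \<open>G/H\<close>,
  and further rotations of one orbit, one for each remaining generator of \<open>G/H\<close>.  If \<open>H\<close> has
  prime index, the twist alone generates \<open>G/H\<close>, so two generators suffice; for \<open>q = 2\<close> there
  are only two constant configurations, and only one orbit for each \<open>H\<close> of index 2, so that one
  generator suffices in these cases.\<close>

section \<open>Generating sets of finite monoids\<close>

text \<open>In a finite group the inverse of \<open>x\<close> is a power of \<open>x\<close>, so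
  closure under products suffices. This reconciles \<open>Rank\<close>, which is defined by
  submonoids, with the subgroup arguments below.\<close>

lemma (in group) finite_submonoid_is_subgroup:
  assumes "finite (carrier G)" "submonoid N G" shows "subgroup N G"
proof -
  interpret N: submonoid N G by fact
  have "inv x \<in> N" if "x \<in> N" for x
  proof -
    have x: "x \<in> carrier G" using that N.subset by blast
    have pow: "x [^] (m::nat) \<in> N" for m
      by (induction m) (use that in auto)
    have "x [^] (order G - 1) \<otimes> x = \<one>"
      using x assms(1) pow_order_eq_1[OF x] order_gt_0_iff_finite
      by (metis Suc_diff_1 nat_pow_Suc)
    then have "inv x = x [^] (order G - 1)"
      using x by (metis inv_equality nat_pow_closed)
    then show ?thesis using pow by simp
  qed
  moreover have "N \<noteq> {}" using N.one_closed by blast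
  ultimately show ?thesis
    using N.subset by (intro subgroupI) auto

qed

lemma Rank_le:
  assumes "monoid M" "T \<subseteq> carrier M" "finite T"
    and "\<And>N. submonoid N M \<Longrightarrow> T \<subseteq> N \<Longrightarrow> carrier M \<subseteq> N"
  shows "Rank M \<le> card T"
proof -
  have "submonoid (carrier M) M"
    using assms(1) by (intro submonoid.intro) (auto simp: monoid.m_closed monoid.one_closed)
  then have "(\<lambda>N. submonoid N M) hull T = carrier M"
    using assms(2,4) unfolding hull_def by blast
  then show ?thesis
    unfolding Rank_def using assms(2,3) by (intro Least_le) blast
qed

text \<open>\<open>Rank\<close> is a \<open>LEAST\<close>, so it is attained only if some finite
  generating set exists; finiteness provides the carrier itself.\<close>

lemma Rank_attained:
  assumes "monoid M" "finite (carrier M)"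
  shows "\<exists>D\<subseteq>carrier M. finite D \<and> card D = Rank M \<and>
    (\<forall>N. submonoid N M \<longrightarrow> D \<subseteq> N \<longrightarrow> carrier M \<subseteq> N)"
proof -
  let ?P = "\<lambda>n. \<exists>T. T \<subseteq> carrier M \<and> finite T \<and> card T = n \<and>
    (\<lambda>N. submonoid N M) hull T = carrier M"
  have sub: "submonoid (carrier M) M"
    using assms(1) by (intro submonoid.intro) (auto simp: monoid.m_closed monoid.one_closed)
  have "(\<lambda>N. submonoid N M) hull carrier M = carrier M"
    using sub unfolding hull_def by blast
  then have "?P (card (carrier M))" using assms(2) by blast
  then have "?P (LEAST n. ?P n)" by (rule LeastI)
  then obtain D where D: "D \<subseteq> carrier M" "finite D" "card D = Rank M"
    "(\<lambda>N. submonoid N M) hull D = carrier M" unfolding Rank_def by blast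
  have "carrier M \<subseteq> N" if "submonoid N M" "D \<subseteq> N" for N
    using hull_minimal[of D N "\<lambda>N. submonoid N M"] that D(4) by simp
  then show ?thesis using D(1-3) by blast
qed

section \<open>Automorphisms of actions with constant stabilizers on orbits\<close>

text \<open>The axiom \<open>act_fixed\<close> makes stabilizers constant along orbits. It is the
  abstract form of what normality of all subgroups gives for the shift.\<close>

locale equistable_action = group G for G (structure) +
  fixes E :: "'x set" and act :: "'a \<Rightarrow> 'x \<Rightarrow> 'x" (infixr "\<star>" 75)
  assumes finite_E: "finite E"
    and act_closed [simp]: "\<lbrakk>g \<in> carrier G; x \<in> E\<rbrakk> \<Longrightarrow> g \<star> x \<in> E"
    and act_one [simp]: "x \<in> E \<Longrightarrow> \<one> \<star> x = x"
    and act_mult: "\<lbrakk>g \<in> carrier G; h \<in> carrier G; x \<in> E\<rbrakk> \<Longrightarrow> (g \<otimes> h) \<star> x = g \<star> h \<star> x"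
    and act_fixed: "\<lbrakk>g \<in> carrier G; h \<in> carrier G; x \<in> E; h \<star> x = x\<rbrakk> \<Longrightarrow> h \<star> g \<star> x = g \<star> x"
begin

definition stab :: "'x \<Rightarrow> 'a set" where "stab x = {g \<in> carrier G. g \<star> x = x}"

definition orb :: "'x \<Rightarrow> 'x set" where "orb x = (\<lambda>g. g \<star> x) ` carrier G"

definition automs :: "('x \<Rightarrow> 'x) set" where
  "automs = {f \<in> E \<rightarrow>\<^sub>E E. bij_betw f E E \<and> (\<forall>g\<in>carrier G. \<forall>x\<in>E. f (g \<star> x) = g \<star> f x)}"

definition Aut :: "('x \<Rightarrow> 'x) monoid" where
  "Aut = \<lparr>carrier = automs, monoid.mult = compose E, one = (\<lambda>x\<in>E. x)\<rparr>"

text \<open>For \<open>x\<close> and \<open>y\<close> with equal stabilizers and \<open>z\<close> in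
  the orbit of \<open>x\<close>, the result does not depend on the chosen \<open>g\<close>.\<close>

definition carry :: "'x \<Rightarrow> 'x \<Rightarrow> 'x \<Rightarrow> 'x" where
  "carry x y z = (SOME g. g \<in> carrier G \<and> g \<star> x = z) \<star> y"

text \<open>For \<open>y\<close> outside the orbit of \<open>x\<close> this swaps the two orbits; for \<open>y = k \<star> x\<close> it sends
  \<open>g \<star> x\<close> to \<open>g \<star> k \<star> x\<close> and fixes all other orbits.\<close>

definition exch :: "'x \<Rightarrow> 'x \<Rightarrow> 'x \<Rightarrow> 'x" where
  "exch x y = (\<lambda>z\<in>E. if z \<in> orb x then carry x y z
    else if z \<in> orb y then carry y x z else z)"

section \<open>Stabilizers and orbits\<close>

lemma act_inv [simp]: "\<lbrakk>g \<in> carrier G; x \<in> E\<rbrakk> \<Longrightarrow> inv g \<star> g \<star> x = x"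
  by (simp flip: act_mult)

lemma act_inv2 [simp]: "\<lbrakk>g \<in> carrier G; x \<in> E\<rbrakk> \<Longrightarrow> g \<star> inv g \<star> x = x"
  by (simp flip: act_mult)

lemma stab_act [simp]: assumes "g \<in> carrier G" "x \<in> E" shows "stab (g \<star> x) = stab x"
proof
  show "stab x \<subseteq> stab (g \<star> x)"
    using act_fixed[OF assms(1) _ assms(2)] unfolding stab_def by blast
  show "stab (g \<star> x) \<subseteq> stab x"
  proof
    fix h assume "h \<in> stab (g \<star> x)"
    then have h: "h \<in> carrier G" "h \<star> g \<star> x = g \<star> x" unfolding stab_def by blast+
    \<comment> \<open>The converse inclusion is \<open>act_fixed\<close> again, applied to the point
      \<open>g \<star> x\<close> and the element \<open>inv g\<close>.\<close>
    have "h \<star> inv g \<star> g \<star> x = inv g \<star> g \<star> x"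
      using assms by (intro act_fixed h act_closed inv_closed)
    then show "h \<in> stab x" unfolding stab_def using h(1) by (simp only: act_inv assms mem_Collect_eq)
  qed
qed

lemma subgroup_stab: assumes "x \<in> E" shows "subgroup (stab x) G"
proof (rule subgroupI)
  show "stab x \<noteq> {}" using assms one_closed act_one unfolding stab_def by blast
next
  fix g assume "g \<in> stab x"
  then show "inv g \<in> stab x"
    using act_inv[of g x] assms unfolding stab_def by auto
next
  fix g h assume "g \<in> stab x" "h \<in> stab x"
  then show "g \<otimes> h \<in> stab x"
    using assms act_mult[of g h x] unfolding stab_def by auto
qed (auto simp: stab_def)

lemma orb_subset: "x \<in> E \<Longrightarrow> orb x \<subseteq> E"
  unfolding orb_def by auto

lemma orb_self [simp]: "x \<in> E \<Longrightarrow> x \<in> orb x"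
  unfolding orb_def using act_one one_closed by (metis imageI)

lemma orb_actI [simp]: "g \<in> carrier G \<Longrightarrow> g \<star> x \<in> orb x"
  unfolding orb_def by auto

lemma act_in_orb_iff [simp]:
  assumes "g \<in> carrier G" "x \<in> E" "z \<in> E" shows "g \<star> z \<in> orb x \<longleftrightarrow> z \<in> orb x"
proof
  assume "g \<star> z \<in> orb x"
  then obtain h where h: "h \<in> carrier G" "g \<star> z = h \<star> x" unfolding orb_def by auto
  then have "z = (inv g \<otimes> h) \<star> x" using assms act_inv[of g z] by (simp add: act_mult)
  then show "z \<in> orb x" using h assms by simp
next
  assume "z \<in> orb x"
  then obtain h where h: "h \<in> carrier G" "z = h \<star> x" unfolding orb_def by auto
  then have "g \<star> z = (g \<otimes> h) \<star> x" using assms by (simp add: act_mult)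
  then show "g \<star> z \<in> orb x" using h assms by simp
qed

lemma orb_eq: assumes "x \<in> E" "y \<in> orb x" shows "orb y = orb x"
proof -
  have yX: "y \<in> E" using assms orb_subset by blast
  obtain g where g: "g \<in> carrier G" "y = g \<star> x" using assms unfolding orb_def by auto
  then have "x = inv g \<star> y" using assms by simp
  then have "x \<in> orb y" using g orb_actI[of "inv g" y] by simp
  then have "g \<star> y \<in> orb x" "g \<star> x \<in> orb y" if "g \<in> carrier G" for g
    using that assms yX by auto
  then show ?thesis
    by (metis (no_types, lifting) image_subset_iff orb_def subset_antisym)
qed

section \<open>Exchange maps between orbits\<close>

lemma carry_act:
  assumes "x \<in> E" "y \<in> E" "stab x = stab y" "g \<in> carrier G"
  shows "carry x y (g \<star> x) = g \<star> y"
proof -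
  define h where "h = (SOME h. h \<in> carrier G \<and> h \<star> x = g \<star> x)"
  have h: "h \<in> carrier G" "h \<star> x = g \<star> x"
    using someI[of "\<lambda>h. h \<in> carrier G \<and> h \<star> x = g \<star> x" g] assms unfolding h_def by auto
  \<comment> \<open>Two elements carrying \<open>x\<close> to the same point differ by an element of
    \<open>stab x = stab y\<close>, so they also agree on \<open>y\<close>.\<close>
  then have "inv g \<otimes> h \<in> stab x" using assms(1,2,4) unfolding stab_def by (simp add: act_mult)
  then have "inv g \<otimes> h \<in> stab y" using assms(3) by simp
  then have "inv g \<star> h \<star> y = y" using assms(2,4) h(1) unfolding stab_def by (simp add: act_mult)
  then have "h \<star> y = g \<star> y" using assms h act_inv2[of g "h \<star> y"] by simp
  then show ?thesis unfolding carry_def h_def by simp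
qed

lemma exch_left:
  assumes "x \<in> E" "y \<in> E" "stab x = stab y" "g \<in> carrier G"
  shows "exch x y (g \<star> x) = g \<star> y"
  using assms by (simp add: exch_def carry_act)

lemma exch_right:
  assumes "x \<in> E" "y \<in> E" "stab x = stab y" "y \<notin> orb x" "g \<in> carrier G"
  shows "exch x y (g \<star> y) = g \<star> x"
  using assms by (simp add: exch_def carry_act)

lemma exch_other:
  assumes "z \<in> E" "z \<notin> orb x" "z \<notin> orb y" shows "exch x y z = z"
  using assms by (simp add: exch_def)

lemma exch_left1:
  assumes "x \<in> E" "y \<in> E" "stab x = stab y" shows "exch x y x = y"
  using exch_left[OF assms one_closed] assms by simp

lemma exch_right1:
  assumes "x \<in> E" "y \<in> E" "stab x = stab y" "y \<notin> orb x" shows "exch x y y = x"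
  using exch_right[OF assms one_closed] assms by simp

lemma automs_closed: "f \<in> automs \<Longrightarrow> x \<in> E \<Longrightarrow> f x \<in> E"
  and automs_act: "f \<in> automs \<Longrightarrow> g \<in> carrier G \<Longrightarrow> x \<in> E \<Longrightarrow> f (g \<star> x) = g \<star> f x"
  and automs_bij: "f \<in> automs \<Longrightarrow> bij_betw f E E"
  and automs_ext: "f \<in> automs \<Longrightarrow> f \<in> extensional E"
  by (simp_all add: automs_def PiE_iff)

lemma automs_inj: "f \<in> automs \<Longrightarrow> x \<in> E \<Longrightarrow> y \<in> E \<Longrightarrow> f x = f y \<longleftrightarrow> x = y"
  by (rule inj_on_eq_iff[OF bij_betw_imp_inj_on[OF automs_bij]])

text \<open>The case \<open>right\<close> carries \<open>y \<notin> orb x\<close>, as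
  \<open>exch_right\<close> demands; if the two orbits coincide, all their points fall under
  \<open>left\<close>.\<close>

lemma exch_cases:
  assumes "x \<in> E" "y \<in> E" "z \<in> E"
  obtains (left) g where "g \<in> carrier G" "z = g \<star> x"
    | (right) g where "y \<notin> orb x" "g \<in> carrier G" "z = g \<star> y"
    | (other) "z \<notin> orb x" "z \<notin> orb y"
proof (cases "z \<in> orb x")
  case True then show ?thesis using left unfolding orb_def by blast
next
  case zx: False
  show ?thesis
  proof (cases "z \<in> orb y")
    case True
    then have "y \<notin> orb x" using assms orb_eq zx by metis
    then show ?thesis using True right unfolding orb_def by blast
  qed (rule other[OF zx])
qed

lemma exch_automs:
  assumes "x \<in> E" "y \<in> E" "stab x = stab y" shows "exch x y \<in> automs"
proof -
  note l = exch_left[OF assms] and r = exch_right[OF assms]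
  have eq: "exch x y z \<in> E \<and> exch x y (g \<star> z) = g \<star> exch x y z"
    if z: "z \<in> E" and g: "g \<in> carrier G" for z g
    using assms(1,2) z
  proof (cases rule: exch_cases)
    case (left h)
    then show ?thesis using l[of h] l[of "g \<otimes> h"] assms g by (simp add: act_mult)
  next
    case (right h)
    then show ?thesis using r[of h] r[of "g \<otimes> h"] assms g by (simp add: act_mult)
  next
    case other
    then show ?thesis using assms g z by (simp add: exch_other)
  qed
  have surj: "z \<in> exch x y ` E" if z: "z \<in> E" for z
  \<comment> \<open>Points of the orbit of \<open>y\<close> are hit from the orbit of
    \<open>x\<close>. Testing this first also settles the situation where both orbits
    coincide.\<close>
  proof (cases "z \<in> orb y")
    case True
    then obtain g where "g \<in> carrier G" "z = g \<star> y" unfolding orb_def by auto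
    then show ?thesis using l assms by (metis act_closed image_eqI)
  next
    case zy: False
    show ?thesis
    proof (cases "z \<in> orb x")
      case True
      then obtain g where g: "g \<in> carrier G" "z = g \<star> x" unfolding orb_def by auto
      have "y \<notin> orb x" using zy True orb_eq assms by metis
      then show ?thesis using r g assms by (metis act_closed image_eqI)
    next
      case False
      then show ?thesis using exch_other zy z by (metis image_eqI)
    qed
  qed
  have "exch x y ` E = E" using surj eq one_closed by blast
  moreover have "inj_on (exch x y) E"
    by (rule finite_surj_inj) (use finite_E surj in auto)
  ultimately show ?thesis
    unfolding automs_def using eq one_closed by (auto simp: bij_betw_def exch_def)
qed

section \<open>The automorphism group of the action\<close>

lemma Aut_simps [simp]: "carrier Aut = automs" "monoid.mult Aut = compose E" "monoid.one Aut = (\<lambda>x\<in>E. x)"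
  unfolding Aut_def by auto

lemma automs_eqI:
  assumes "f \<in> automs" "f' \<in> automs" "\<And>x. x \<in> E \<Longrightarrow> f x = f' x" shows "f = f'"
  using assms automs_ext extensionalityI by blast

lemma compose_automs: "f \<in> automs \<Longrightarrow> f' \<in> automs \<Longrightarrow> compose E f f' \<in> automs"
  using bij_betw_compose[of f' E E f E] unfolding automs_def
  by (auto simp: compose_eq PiE_iff)

lemma id_automs: "(\<lambda>x\<in>E. x) \<in> automs"
  unfolding automs_def by (auto simp: bij_betw_def)

lemma group_Aut: "group Aut"
proof (rule groupI; unfold Aut_simps)
  fix f assume f: "f \<in> automs"
  let ?i = "\<lambda>y\<in>E. inv_into E f y"
  have b: "bij_betw f E E" using f by (rule automs_bij)
  have "bij_betw ?i E E"
    using bij_betw_inv_into[OF b] by (simp add: bij_betw_def inj_on_def)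
  moreover have "inv_into E f (g \<star> y) = g \<star> inv_into E f y"
    if "g \<in> carrier G" "y \<in> E" for g y
  proof -
    have "inv_into E f y \<in> E" "f (inv_into E f y) = y"
      using b that by (auto simp: bij_betw_def inv_into_into f_inv_into_f)
    then show ?thesis
      using b that automs_act[OF f, of g "inv_into E f y"]
      by (metis act_closed bij_betw_inv_into_left)
  qed
  ultimately have "?i \<in> automs"
    unfolding automs_def by (auto simp: bij_betw_def)
  moreover have "compose E ?i f = (\<lambda>x\<in>E. x)"
    using b by (intro compose_inv_into_id)
  ultimately show "\<exists>h\<in>automs. compose E h f = (\<lambda>x\<in>E. x)" by blast
next
  fix f f' f'' assume "f \<in> automs" "f' \<in> automs" "f'' \<in> automs"
  then show "compose E (compose E f f') f'' = compose E f (compose E f' f'')"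
    by (intro compose_assoc[symmetric]) (auto simp: automs_def)
next
  fix f assume "f \<in> automs"
  then show "compose E (\<lambda>x\<in>E. x) f = f"
    by (intro automs_eqI) (auto simp: compose_eq automs_closed intro: compose_automs id_automs)
qed (auto intro: compose_automs id_automs)

lemma finite_automs: "finite automs"
proof (rule finite_subset)
  show "automs \<subseteq> E \<rightarrow>\<^sub>E E" unfolding automs_def by auto
qed (simp add: finite_E finite_PiE)

lemma automs_stab: assumes "f \<in> automs" "x \<in> E" shows "stab (f x) = stab x"
  using assms automs_act[OF assms(1)] automs_inj[OF assms(1)]
  unfolding stab_def by (metis act_closed)

lemma automs_orb: assumes "f \<in> automs" "x \<in> E" "z \<in> E" shows "f z \<in> orb (f x) \<longleftrightarrow> z \<in> orb x"
  using assms automs_act[OF assms(1)] automs_inj[OF assms(1)]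
  unfolding orb_def by (smt (verit) act_closed image_iff)

text \<open>An automorphism preserves orbits and stabilizers and commutes with the action, so it
  relabels an exchange just as a permutation relabels a transposition.\<close>

lemma exch_conj:
  assumes f: "f \<in> automs" and xy: "x \<in> E" "y \<in> E" "stab x = stab y"
  shows "compose E f (exch x y) = compose E (exch (f x) (f y)) f"
proof (rule automs_eqI)
  have fxy: "f x \<in> E" "f y \<in> E" "stab (f x) = stab (f y)"
    using f xy by (auto simp: automs_closed automs_stab)
  show "compose E f (exch x y) \<in> automs" "compose E (exch (f x) (f y)) f \<in> automs"
    using f xy fxy by (auto intro: compose_automs exch_automs)
  fix z assume z: "z \<in> E"
  have "f (exch x y z) = exch (f x) (f y) (f z)"
    using xy(1,2) z
  proof (cases rule: exch_cases)
    case (left g)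
    then show ?thesis using xy f fxy by (simp add: exch_left automs_act)
  next
    case (right g)
    then have "f y \<notin> orb (f x)" using automs_orb f xy by blast
    then show ?thesis using right xy f fxy by (simp add: exch_right automs_act)
  next
    case other
    then have "f z \<notin> orb (f x)" "f z \<notin> orb (f y)" using automs_orb f xy z by blast+
    then show ?thesis using other z f by (simp add: exch_other automs_closed)
  qed
  then show "compose E f (exch x y) z = compose E (exch (f x) (f y)) f z"
    using z by (simp add: compose_eq)
qed

text \<open>This is the device for deriving new exchanges from given generators: only the values of
  \<open>f\<close> at \<open>x\<close> and \<open>y\<close> have to be known.\<close>

lemma exch_conj_mem:
  assumes N: "subgroup N Aut" and f: "f \<in> N" and e: "exch x y \<in> N"
    and xy: "x \<in> E" "y \<in> E" "stab x = stab y"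
  shows "exch (f x) (f y) \<in> N"
proof -
  interpret A: group Aut by (rule group_Aut)
  have fA: "f \<in> automs" using f subgroup.subset[OF N] by auto
  then have "exch (f x) (f y) \<in> automs"
    using xy by (intro exch_automs) (auto simp: automs_closed automs_stab)
  then have "exch (f x) (f y) = (f \<otimes>\<^bsub>Aut\<^esub> exch x y) \<otimes>\<^bsub>Aut\<^esub> inv\<^bsub>Aut\<^esub> f"
    using exch_conj[OF fA xy] fA exch_automs[OF xy]
    by (subst A.inv_solve_right) (auto intro: compose_automs)
  then show ?thesis
    using N f e by (metis subgroup.m_closed subgroup.m_inv_closed)
qed

text \<open>Any moved representative \<open>x\<close> can be put back by \<open>inv (exch x (f x))\<close>, and
  this moves no point that \<open>f\<close> fixed.\<close>

lemma automs_generated_by_exch: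
  assumes N: "subgroup N Aut"
    and R: "R \<subseteq> E" "\<And>z. z \<in> E \<Longrightarrow> \<exists>x\<in>R. z \<in> orb x"
    and e: "\<And>x y. \<lbrakk>x \<in> R; y \<in> E; stab x = stab y\<rbrakk> \<Longrightarrow> exch x y \<in> N"
  shows "automs \<subseteq> N"
proof
  interpret A: group Aut by (rule group_Aut)
  fix f assume "f \<in> automs"
  then show "f \<in> N"
  proof (induction "card {z \<in> E. f z \<noteq> z}" arbitrary: f rule: less_induct)
    case less
    note f = less.prems
    show ?case
    proof (cases "\<exists>x\<in>R. f x \<noteq> x")
      case False
      \<comment> \<open>Every point is \<open>g \<star> x\<close> with \<open>x\<close> in
        \<open>R\<close>, so equivariance spreads the fixed points over all of
        \<open>E\<close>.\<close>
      have "f = (\<lambda>x\<in>E. x)"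
      proof (intro automs_eqI f id_automs)
        fix z assume z: "z \<in> E"
        then obtain x g where "x \<in> R" "g \<in> carrier G" "z = g \<star> x"
          using R unfolding orb_def by blast
        then show "f z = (\<lambda>x\<in>E. x) z" using automs_act[OF f] False R z by auto
      qed
      then show ?thesis using subgroup.one_closed[OF N] by simp
    next
      case True
      then obtain x where x: "x \<in> R" "x \<in> E" "f x \<noteq> x" using R by blast
      define u where "u = exch x (f x)"
      have fx: "f x \<in> E" "stab x = stab (f x)"
        using f x by (auto simp: automs_closed automs_stab)
      have uN: "u \<in> N" unfolding u_def using e x fx by blast
      have uA: "u \<in> automs" unfolding u_def using exch_automs x fx by blast
      define f' where "f' = inv\<^bsub>Aut\<^esub> u \<otimes>\<^bsub>Aut\<^esub> f"
      have f'A: "f' \<in> automs" unfolding f'_def using uA f A.m_closed A.inv_closed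
        by (metis Aut_simps(1))
      have ff': "f = u \<otimes>\<^bsub>Aut\<^esub> f'" unfolding f'_def using uA f
        by (metis A.inv_closed A.inv_solve_left' A.m_closed Aut_simps(1))
      have uf': "u (f' z) = f z" if "z \<in> E" for z
        using that ff' by (simp add: compose_eq)
      have fixu: "f' z = z" if z: "z \<in> E" "u z = f z" for z
        using uf'[of z] automs_inj[OF uA] automs_closed[OF f'A] z by metis
      have "f' x = x" using fixu x fx unfolding u_def by (simp add: exch_left1)
      moreover have "f' z = z" if z: "z \<in> E" "f z = z" for z
      proof -
        \<comment> \<open>A fixed point \<open>g \<star> x\<close> of \<open>f\<close> would force
          \<open>f x = x\<close>.\<close>
        have 1: "z \<notin> orb x"
        proof
          assume "z \<in> orb x"
          then obtain g where g: "g \<in> carrier G" "z = g \<star> x" unfolding orb_def by auto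
          then have "g \<star> f x = g \<star> x" using automs_act[OF f] x z by metis
          then show False using g x fx by (metis act_inv)
        qed
        \<comment> \<open>Since \<open>f z = z\<close>, lying in \<open>orb (f x)\<close> would mean
          lying in \<open>orb x\<close>. Hence \<open>u\<close> fixes \<open>z\<close>.\<close>
        have "z \<notin> orb (f x)" using automs_orb[OF f, of x z] 1 z x by auto
        then show ?thesis using fixu exch_other 1 z unfolding u_def by metis
      qed
      ultimately have "{z \<in> E. f' z \<noteq> z} \<subset> {z \<in> E. f z \<noteq> z}"
        using x by auto
      then have "card {z \<in> E. f' z \<noteq> z} < card {z \<in> E. f z \<noteq> z}"
        using finite_E by (intro psubset_card_mono) auto
      then have "f' \<in> N" using less.hyps f'A by blast
      then show ?thesis using ff' uN subgroup.m_closed[OF N] by simp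
    qed
  qed
qed

section \<open>Cycles of orbits and generators of a single block\<close>

primrec cyc :: "(nat \<Rightarrow> 'x) \<Rightarrow> nat \<Rightarrow> 'x \<Rightarrow> 'x" where
  "cyc x 0 = (\<lambda>z\<in>E. z)"
| "cyc x (Suc m) = compose E (cyc x m) (exch (x m) (x (Suc m)))"


lemma exch_self: assumes "x \<in> E" shows "exch x x = (\<lambda>z\<in>E. z)"
proof (intro automs_eqI exch_automs id_automs assms refl)
  fix z assume z: "z \<in> E"
  from assms assms z show "exch x x z = (\<lambda>z\<in>E. z) z"
    by (cases rule: exch_cases) (use assms z in \<open>auto simp: exch_left exch_other\<close>)
qed

text \<open>The map \<open>cyc x m\<close> cyclically permutes the orbits of \<open>x 0\<close>,
  ..., \<open>x m\<close>. As a product of adjacent exchanges it lies in every subgroup containing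
  them.\<close>

lemma
  assumes x: "\<And>i. i < n \<Longrightarrow> x i \<in> E" "\<And>i. i < n \<Longrightarrow> stab (x i) = H"
    and disj: "\<And>i j. \<lbrakk>i < n; j < n; i \<noteq> j\<rbrakk> \<Longrightarrow> x j \<notin> orb (x i)"
  shows cyc_automs: "m < n \<Longrightarrow> cyc x m \<in> automs"
    and cyc_below: "\<lbrakk>m < n; i < m\<rbrakk> \<Longrightarrow> cyc x m (x i) = x (Suc i)"
proof -
  show 1: "m < n \<Longrightarrow> cyc x m \<in> automs"
    by (induction m) (auto intro!: compose_automs id_automs exch_automs simp: x)
  \<comment> \<open>Later points are not yet moved; so \<open>cyc x m\<close> leaves
    \<open>x (Suc m)\<close> alone after the new exchange has sent \<open>x m\<close> there.\<close>
  have 2: "cyc x m (x i) = x i" if "m < n" "m < i" "i < n" for m i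
    using that
  proof (induction m)
    case (Suc m)
    then have "exch (x m) (x (Suc m)) (x i) = x i" by (intro exch_other x disj) auto
    then show ?case using Suc x by (simp add: compose_eq)
  qed (simp add: x)
  show "\<lbrakk>m < n; i < m\<rbrakk> \<Longrightarrow> cyc x m (x i) = x (Suc i)"
  proof (induction m)
    case (Suc m)
    show ?case
    proof (cases "i = m")
      case True
      then show ?thesis using Suc x 2[of m "Suc m"] by (simp add: compose_eq exch_left1)
    next
      case False
      then have "exch (x m) (x (Suc m)) (x i) = x i" using Suc by (intro exch_other x disj) auto
      then show ?thesis using Suc x False by (simp add: compose_eq)
    qed
  qed simp
qed

text \<open>The generators are a transposition, a full cycle twisted by \<open>k\<close> at one orbit, and a rotation
  for each \<open>d \<in> D\<close>.  Conjugating by the twisted cycle still yields all untwisted adjacent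
  transpositions, which recover the cycle and then the twist.  If \<open>n = 2\<close> and \<open>k \<in> H\<close>, the
  first two generators coincide.\<close>

lemma block_generators:
  fixes n :: nat
  assumes x: "\<And>i. i < n \<Longrightarrow> x i \<in> E" "\<And>i. i < n \<Longrightarrow> stab (x i) = H"
    and disj: "\<And>i j. \<lbrakk>i < n; j < n; i \<noteq> j\<rbrakk> \<Longrightarrow> x j \<notin> orb (x i)"
    and cover: "\<And>y. \<lbrakk>y \<in> E; stab y = H\<rbrakk> \<Longrightarrow> \<exists>j<n. y \<in> orb (x j)"
    and k: "k \<in> carrier G" and D: "D \<subseteq> carrier G" "finite D"
    and gen: "\<And>K. \<lbrakk>submonoid K G; H \<subseteq> K; insert k D \<subseteq> K\<rbrakk> \<Longrightarrow> carrier G \<subseteq> K"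
  obtains T where "T \<subseteq> automs" "finite T"
    "card T \<le> card D + (if n \<le> 1 \<or> n = 2 \<and> k \<in> H then 1 else 2)"
    "\<And>N i y. \<lbrakk>subgroup N Aut; T \<subseteq> N; i < n; y \<in> E; stab y = H\<rbrakk> \<Longrightarrow> exch (x i) y \<in> N"
proof (cases "n = 0")
  case True
  then show thesis by (intro that[of "{}"]) auto
next
  case False
  interpret A: group Aut by (rule group_Aut)
  note cyc = cyc_automs[of n x H, OF x disj] cyc_below[of n x H, OF x disj]
  have x0: "x 0 \<in> E" "stab (x 0) = H" using x False by auto
  define r where "r = exch (x 0) (k \<star> x 0)"
  \<comment> \<open>Counting starts at 0, so the cycle through all \<open>n\<close> orbits has last
    index \<open>n - 1\<close>.\<close>
  define c where "c = cyc x (n - 1)"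
  define S where "S = (if n = 1 then {} else {exch (x 0) (x 1)})"
  define T where "T = insert (compose E r c) S \<union> (\<lambda>d. exch (x 0) (d \<star> x 0)) ` D"
  have r: "r \<in> automs" unfolding r_def using x0 k by (intro exch_automs) auto
  have c: "c \<in> automs" unfolding c_def using cyc False by auto
  have SA: "S \<subseteq> automs" unfolding S_def using x False by (auto intro: exch_automs)
  have card1: "card (insert (compose E r c) S) \<le> (if n \<le> 1 \<or> n = 2 \<and> k \<in> H then 1 else 2)"
  \<comment> \<open>With \<open>k\<close> in the stabilizer the twist \<open>r\<close> is the
    identity, and \<open>c\<close> is the single exchange already in \<open>S\<close>.\<close>
  proof (cases "n = 2 \<and> k \<in> H")
    case True
    then have "k \<star> x 0 = x 0" using x0(2) unfolding stab_def by auto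
    then have rid: "r = (\<lambda>z\<in>E. z)" unfolding r_def using x0 by (simp add: exch_self)
    have "c = compose E (\<lambda>z\<in>E. z) (exch (x 0) (x 1))" unfolding c_def using True by simp
    also have "\<dots> = exch (x 0) (x 1)"
      using A.l_one[of "exch (x 0) (x 1)"] x True by (simp add: exch_automs)
    finally have "compose E r c = exch (x 0) (x 1)"
      using rid A.l_one[of "exch (x 0) (x 1)"] x True by (simp add: exch_automs)
    then show ?thesis using True unfolding S_def by simp
  qed (use False in \<open>auto simp: S_def card_insert_if\<close>)
  show thesis
  proof (rule that[of T])
    show "T \<subseteq> automs"
      unfolding T_def using SA r c x0 D by (auto intro!: compose_automs exch_automs)
    show "finite T" unfolding T_def S_def using D by auto
    have "card T \<le> card (insert (compose E r c) S) + card ((\<lambda>d. exch (x 0) (d \<star> x 0)) ` D)"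
      unfolding T_def by (rule card_Un_le)
    also have "\<dots> \<le> (if n \<le> 1 \<or> n = 2 \<and> k \<in> H then 1 else 2) + card D"
      using card1 card_image_le[OF D(2)] by (intro add_mono)
    finally show "card T \<le> card D + (if n \<le> 1 \<or> n = 2 \<and> k \<in> H then 1 else 2)" by simp
  next
    fix N i y assume N: "subgroup N Aut" and TN: "T \<subseteq> N"
      and i: "i < n" and y: "y \<in> E" "stab y = H"
    interpret N: subgroup N Aut by (rule N)
    have idN: "(\<lambda>z\<in>E. z) \<in> N" using N.one_closed by simp
    have rcN: "compose E r c \<in> N" using TN unfolding T_def by auto
    note conj = exch_conj_mem[OF N]
    have adj: "exch (x m) (x (Suc m)) \<in> N" if "Suc m < n" for m
      using that
    proof (induction m)
      case 0
      then show ?case using TN unfolding T_def S_def by auto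
    next
      case (Suc m)
      \<comment> \<open>\<open>c\<close> sends \<open>x l\<close> to \<open>x (Suc l)\<close>,
        outside the orbit of \<open>x 0\<close>, where \<open>r\<close> is the identity. Conjugation
        by the twisted cycle thus advances both indices of an adjacent exchange.\<close>
      have "compose E r c (x l) = x (Suc l)" if "Suc l < n" for l
      proof -
        have "x (Suc l) \<notin> orb (x 0)" using disj that by auto
        moreover have "orb (k \<star> x 0) = orb (x 0)" using x0 k by (intro orb_eq) auto
        ultimately have "r (x (Suc l)) = x (Suc l)"
          unfolding r_def using x that by (intro exch_other) auto
        then show ?thesis using that x cyc(2)[of "n - 1" l] unfolding c_def
          by (simp add: compose_eq)
      qed
      then show ?case using conj[OF rcN Suc.IH] Suc.prems x by auto
    qed
    have "cyc x m \<in> N" if "m < n" for m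
      using that
    proof (induction m)
      case (Suc m)
      then show ?case using adj N.m_closed[of "cyc x m"] by simp
    qed (simp add: idN)
    then have cN: "c \<in> N" unfolding c_def using False by auto
    have "r = (r \<otimes>\<^bsub>Aut\<^esub> c) \<otimes>\<^bsub>Aut\<^esub> inv\<^bsub>Aut\<^esub> c"
      using r c compose_automs by (subst A.inv_solve_right) auto
    then have rN: "r \<in> N" using rcN cN N.m_closed N.m_inv_closed by (metis Aut_simps(2))
    \<comment> \<open>These elements give the rotations of the orbit of \<open>x 0\<close> available
      in \<open>N\<close>. They form a submonoid containing \<open>H\<close>, \<open>k\<close> and
      \<open>D\<close>, so \<open>gen\<close> makes it everything.\<close>
    define K where "K = {g \<in> carrier G. exch (x 0) (g \<star> x 0) \<in> N}"
    have HK: "H \<subseteq> K"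
    proof
      fix h assume "h \<in> H"
      then have "h \<in> carrier G" "h \<star> x 0 = x 0" using x0(2) unfolding stab_def by auto
      then show "h \<in> K" unfolding K_def using x0 idN by (simp add: exch_self)
    qed
    have "submonoid K G"
    proof
      show "\<one> \<in> K" unfolding K_def using x0 idN by (simp add: exch_self)
      fix g h assume gh: "g \<in> K" "h \<in> K"
      then have g: "g \<in> carrier G" "h \<in> carrier G" unfolding K_def by auto
      have "exch (x 0) (h \<star> x 0) \<otimes>\<^bsub>Aut\<^esub> exch (x 0) (g \<star> x 0) \<in> N"
        using gh N.m_closed unfolding K_def by blast
      \<comment> \<open>A rotation multiplies \<open>u\<close> in \<open>u \<star> x 0\<close> from
        the right, so composition reverses the order of the factors.\<close>
      moreover have "exch (x 0) (h \<star> x 0) \<otimes>\<^bsub>Aut\<^esub> exch (x 0) (g \<star> x 0)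
          = exch (x 0) ((g \<otimes> h) \<star> x 0)"
        unfolding Aut_simps
      proof (rule automs_eqI)
        fix z assume z: "z \<in> E"
        have o: "orb (g \<star> x 0) = orb (x 0)" if "g \<in> carrier G" for g
          using x0 that by (intro orb_eq) auto
        show "compose E (exch (x 0) (h \<star> x 0)) (exch (x 0) (g \<star> x 0)) z
          = exch (x 0) ((g \<otimes> h) \<star> x 0) z"
        proof (cases "z \<in> orb (x 0)")
          case True
          then obtain u where "u \<in> carrier G" "z = u \<star> x 0" unfolding orb_def by auto
          then show ?thesis using x0 g exch_left[of "x 0" "h \<star> x 0" "u \<otimes> g"]
            by (simp add: compose_eq exch_left act_mult)
        next
          case False
          then show ?thesis using z o g by (simp add: compose_eq exch_other)
        qed
      qed (use x0 g in \<open>auto intro!: compose_automs exch_automs\<close>)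
      ultimately show "g \<otimes> h \<in> K" unfolding K_def using g by simp
    qed (auto simp: K_def)
    moreover have "insert k D \<subseteq> K"
      using rN TN k D unfolding K_def r_def T_def by auto
    ultimately have "carrier G \<subseteq> K" using gen HK by blast
    then have rot0: "exch (x 0) (g \<star> x 0) \<in> N" if "g \<in> carrier G" for g
      using that unfolding K_def by auto
    \<comment> \<open>For \<open>j \<noteq> 0\<close>, the exchange of \<open>x j\<close> and
      \<open>x (Suc j)\<close> fixes \<open>x 0\<close>, so conjugation by it advances the second
      point only.\<close>
    have e0: "exch (x 0) (x j) \<in> N" if "j < n" for j
      using that
    proof (induction j)
      case (Suc j)
      show ?case
      proof (cases "j = 0")
        case False
        let ?f = "exch (x j) (x (Suc j))"
        have "?f (x 0) = x 0" using False Suc.prems by (intro exch_other x disj) auto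
        moreover have "?f (x j) = x (Suc j)" using Suc.prems x by (intro exch_left1) auto
        ultimately show ?thesis
          using conj[OF adj[OF Suc.prems], of "x 0" "x j"] Suc x by auto
      qed (use adj Suc in auto)
    qed (use x0 idN in \<open>simp add: exch_self\<close>)
    \<comment> \<open>Conjugation by \<open>exch (x 0) (x j)\<close> transports the rotations to the
      orbit of \<open>x j\<close>.\<close>
    have rot: "exch (x j) (g \<star> x j) \<in> N" if "j < n" "g \<in> carrier G" for j g
      using conj[OF e0[OF that(1)] rot0[OF that(2)]] x0 x that by (auto simp: exch_left exch_left1)
    have eij: "exch (x i) (x j) \<in> N" if "i \<noteq> j" "j < n" for j
    proof -
      have fi: "exch (x 0) (x i) (x 0) = x i" using x0 x i by (intro exch_left1) auto
      show ?thesis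
      proof (cases "j = 0")
        case True
        \<comment> \<open>Conjugating this exchange by itself swaps its two arguments.\<close>
        then have "exch (x 0) (x i) (x i) = x 0"
          using x0 x i that disj[of 0 i] by (intro exch_right1) auto
        then show ?thesis using conj[OF e0[OF i] e0[OF i]] fi x0 x i True by auto
      next
        case False
        then have "exch (x 0) (x i) (x j) = x j" using that i by (intro exch_other x disj) auto
        then show ?thesis using conj[OF e0[OF i] e0[OF that(2)]] fi x0 x that by auto
      qed
    qed
    obtain j g where j: "j < n" "g \<in> carrier G" "y = g \<star> x j"
      using cover[OF y] unfolding orb_def by auto
    show "exch (x i) y \<in> N"
    proof (cases "i = j")
      case False
      \<comment> \<open>This rotation fixes \<open>x i\<close> and takes \<open>x j\<close> to
        \<open>y\<close>, so it turns the exchange of \<open>x i\<close> with \<open>x j\<close>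
        into the one with \<open>y\<close>.\<close>
      let ?f = "exch (x j) (g \<star> x j)"
      have "orb (g \<star> x j) = orb (x j)" using x j by (intro orb_eq) auto
      then have "?f (x i) = x i" using i j False disj[of j i] x by (intro exch_other) auto
      moreover have "?f (x j) = g \<star> x j" using x j by (intro exch_left1) auto
      ultimately show ?thesis
        using conj[OF rot[OF j(1,2)] eij[OF False j(1)]] j i x by auto
    qed (use rot j in auto)
  qed
qed

text \<open>The finitely many orbits of points with stabilizer \<open>H\<close> are numbered
  injectively, and one point is chosen in each; \<open>n = 0\<close> is possible.\<close>

lemma block_representatives:
  "\<exists>n x. (\<forall>i<n. x i \<in> E \<and> stab (x i) = H) \<and>
    (\<forall>i<n. \<forall>j<n. i \<noteq> j \<longrightarrow> x j \<notin> orb (x i)) \<and>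
    (\<forall>y\<in>E. stab y = H \<longrightarrow> (\<exists>j<n::nat. y \<in> orb (x j)))"
proof -
  let ?B = "{y \<in> E. stab y = H}"
  have "finite (orb ` ?B)" using finite_E by auto
  from finite_imp_nat_seg_image_inj_on[OF this]
  obtain n :: nat and O' where O': "orb ` ?B = O' ` {i. i < n}" "inj_on O' {i. i < n}"
    by blast
  have "\<exists>y\<in>?B. orb y = O' i" if "i < n" for i
  proof -
    have "O' i \<in> orb ` ?B" using that unfolding O'(1) by blast
    then show ?thesis by blast
  qed
  then obtain x where x: "\<And>i. i < n \<Longrightarrow> x i \<in> ?B \<and> orb (x i) = O' i" by metis
  show ?thesis
  proof (rule exI[of _ n], rule exI[of _ x], intro conjI allI impI ballI)
    fix i j assume ij: "i < n" "j < n" "i \<noteq> j"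
    show "x j \<notin> orb (x i)"
    proof
      assume "x j \<in> orb (x i)"
      then have "O' j = O' i" using orb_eq[of "x i" "x j"] x ij by auto
      then show False using O'(2) ij by (auto dest: inj_onD)
    qed
  next
    fix y assume y: "y \<in> E" "stab y = H"
    then have "orb y \<in> O' ` {i. i < n}" using O'(1) by blast
    then obtain j where "j < n" "orb y = orb (x j)" using x by auto
    then show "\<exists>j<n. y \<in> orb (x j)" using y orb_self by blast
  qed (use x in auto)
qed

end

section \<open>Subgroups of Dedekind groups\<close>

text \<open>Conjugation fixes every normal subgroup, so the classes are singletons. A general
  \<open>S\<close> serves both \<open>r\<close> and each \<open>r_i\<close>.\<close>

lemma (in group) subgroup_classes_dedekind:
  assumes "dedekind_group G" and S: "\<And>H. H \<in> S \<Longrightarrow> subgroup H G"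
  shows "card (orbits G S (subgroup_conj G)) = card S"
proof -
  have "subgroup_conj G g H = H" if "H \<in> S" "g \<in> carrier G" for g H
  proof -
    have "H \<lhd> G" using assms(1) S that(1) unfolding dedekind_group_def by blast
    then have "g <# H = H #> g" using normal.coset_eq that(2) by blast
    moreover have "H \<subseteq> carrier G" using S that(1) subgroup.subset by blast
    ultimately show ?thesis
      using that(2) by (simp add: subgroup_conj_def coset_mult_assoc coset_mult_one)
  qed
  then have "orbit G (subgroup_conj G) H = {H}" if "H \<in> S" for H
    using that one_closed unfolding orbit_def by auto
  then have "orbits G S (subgroup_conj G) = (\<lambda>H. {H}) ` S"
    unfolding orbits_def by auto
  then show ?thesis by (simp add: card_image)
qed

lemma (in group) card_rcosets_carrier:
  assumes "finite (carrier G)" shows "card (rcosets (carrier G)) = 1"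
proof -
  have "card (rcosets (carrier G)) * order G = 1 * order G"
    using lagrange[OF subgroup_self] unfolding order_def by simp
  moreover have "order G > 0" using assms order_gt_0_iff_finite by blast
  ultimately show ?thesis by (metis mult_cancel2 not_gr_zero)
qed

text \<open>The factor \<open>a\<close> is the index of \<open>H\<close> in \<open>K\<close>. It
  divides the prime index of \<open>H\<close> and is not 1, which leaves index 1 for
  \<open>K\<close>. Hence any element outside \<open>H\<close> generates the group together with
  \<open>H\<close>.\<close>

lemma (in group) prime_index_maximal:
  assumes fin: "finite (carrier G)" and H: "subgroup H G" and K: "subgroup K G"
    and p: "Factorial_Ring.prime (card (rcosets H))" and HK: "H \<subset> K"
  shows "K = carrier G"
proof -
  have finK: "finite K" using fin K finite_subset subgroup.subset by blast
  have "subgroup H (G\<lparr>carrier := K\<rparr>)" using subgroup_incl[OF H K] HK by blast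
  then have "card H dvd card K"
    using group.lagrange[OF subgroup.subgroup_is_group[OF K is_group], of H]
    unfolding order_def by (metis dvd_triv_right partial_object.select_convs(1)
        partial_object.surjective partial_object.update_convs(1))
  then obtain a where a: "card K = card H * a" by blast
  have H0: "card H > 0"
    using H finK HK by (metis card_gt_0_iff empty_iff finite_subset psubset_imp_subset subgroup.one_closed)
  have "card (rcosets K) * (card H * a) = card (rcosets H) * card H"
    using lagrange[OF H] lagrange[OF K] a by simp
  then have "card (rcosets H) = card (rcosets K) * a" using H0 by (simp add: ac_simps)
  moreover have "a \<noteq> 1" using a psubset_card_mono[OF finK HK] by auto
  ultimately have "card (rcosets K) = 1"
    using p by (metis dvd_triv_left mult.right_neutral nat_mult_eq_cancel_disj not_prime_0 prime_nat_iff)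
  then have "card K = order G" using lagrange[OF K] by simp
  then show ?thesis
    using fin subgroup.subset[OF K] unfolding order_def by (intro card_subset_eq) auto
qed

section \<open>Cellular automata over finite Dedekind groups\<close>

lemma card_2_other_unique:
  assumes "card A = 2" "u \<in> A" "v \<in> A" "w \<in> A" "u \<noteq> w" "v \<noteq> w" shows "u = v"
  using assms by (auto simp: card_2_iff)

locale dedekind_shift = group G for G (structure) +
  fixes A :: "'c set"
  assumes dedekind: "dedekind_group G"
    and finite_G: "finite (carrier G)"
    and finite_A: "finite A"
begin

section \<open>The shift action on configurations\<close>

lemma shift_apply: "h \<in> carrier G \<Longrightarrow> shift G g x h = x (inv g \<otimes> h)"
  by (simp add: shift_def)

lemma shift_configs: "\<lbrakk>g \<in> carrier G; x \<in> configs G A\<rbrakk> \<Longrightarrow> shift G g x \<in> configs G A"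
  by (auto simp: configs_def shift_def)

lemma config_val: "\<lbrakk>x \<in> configs G A; g \<in> carrier G\<rbrakk> \<Longrightarrow> x g \<in> A"
  unfolding configs_def by (rule PiE_mem)

lemma shift_mult:
  assumes "g \<in> carrier G" "h \<in> carrier G"
  shows "shift G (g \<otimes> h) x = shift G g (shift G h x)"
  using assms by (auto simp: shift_def inv_mult_group m_assoc)

lemma configs_eqI:
  assumes "x \<in> configs G A" "y \<in> configs G A" "\<And>g. g \<in> carrier G \<Longrightarrow> x g = y g"
  shows "x = y"
  using assms unfolding configs_def by (rule PiE_ext)

lemma shift_constant:
  assumes x: "x \<in> configs G A"
    and const: "\<And>g h. \<lbrakk>g \<in> carrier G; h \<in> carrier G\<rbrakk> \<Longrightarrow> x g = x h" and k: "k \<in> carrier G"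
  shows "shift G k x = x"
proof (rule configs_eqI[OF shift_configs[OF k x] x])
  fix g assume g: "g \<in> carrier G"
  have "x (inv k \<otimes> g) = x g" using g k by (intro const) auto
  then show "shift G k x g = x g" using g by (simp add: shift_apply)
qed

lemma shift_one: "x \<in> configs G A \<Longrightarrow> shift G \<one> x = x"
  by (rule configs_eqI) (auto simp: shift_configs shift_apply)

text \<open>The stabilizer of \<open>x\<close> is normal, so it contains
  \<open>inv g \<otimes> h \<otimes> g\<close>. This is the axiom \<open>act_fixed\<close> for the
  shift.\<close>

lemma shift_fixed:
  assumes g: "g \<in> carrier G" and h: "h \<in> carrier G" and x: "x \<in> configs G A"
    and fixed: "shift G h x = x"
  shows "shift G h (shift G g x) = shift G g x"
proof -
  \<comment> \<open>This is the stabilizer of \<open>x\<close>; \<open>subgroup_stab\<close> becomes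
    available only once \<open>act_fixed\<close> is established.\<close>
  let ?K = "{k \<in> carrier G. shift G k x = x}"
  have "subgroup ?K G"
  proof (rule subgroupI)
    show "?K \<noteq> {}" using shift_one[OF x] by blast
    fix k assume k: "k \<in> ?K"
    then have "shift G (inv k) x = shift G (inv k \<otimes> k) x"
      using shift_mult[of "inv k" k x] by simp
    then show "inv k \<in> ?K" using k shift_one[OF x] by simp
  qed (auto simp: shift_mult)
  then have "?K \<lhd> G" using dedekind unfolding dedekind_group_def by blast
  then have "inv g \<otimes> h \<otimes> g \<in> ?K"
    using normal.inv_op_closed1 g h fixed by fastforce
  then have "shift G g (shift G (inv g \<otimes> h \<otimes> g) x) = shift G g x" by simp
  moreover have "g \<otimes> (inv g \<otimes> h \<otimes> g) = h \<otimes> g" using g h by (simp add: inv_solve_left m_assoc flip: m_assoc)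
  ultimately show ?thesis using g h shift_mult by (metis inv_closed m_closed)
qed

end

sublocale dedekind_shift \<subseteq> equistable_action G "configs G A" "shift G"
proof
  show "finite (configs G A)"
    unfolding configs_def using finite_G finite_A by (simp add: finite_PiE)
qed (auto simp: shift_configs shift_one shift_mult shift_fixed)

section \<open>Cellular automata as equivariant maps\<close>

context dedekind_shift
begin

text \<open>A finite group can serve as its own memory set, so equivariance alone yields a local
  rule, namely the value at \<open>\<one>\<close>.\<close>

lemma cellular_automaton_iff:
  "cellular_automaton G A \<tau> \<longleftrightarrow> \<tau> \<in> configs G A \<rightarrow>\<^sub>E configs G A \<and>
    (\<forall>g\<in>carrier G. \<forall>x\<in>configs G A. \<tau> (shift G g x) = shift G g (\<tau> x))"
  (is "_ \<longleftrightarrow> ?maps \<and> ?equiv")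
proof (intro iffI conjI ballI)
  assume "cellular_automaton G A \<tau>"
  then show maps: ?maps unfolding cellular_automaton_def by blast
  obtain S \<mu> where \<mu>: "\<And>x g. \<lbrakk>x \<in> configs G A; g \<in> carrier G\<rbrakk> \<Longrightarrow>
      \<tau> x g = \<mu> (restrict (shift G (inv g) x) S)"
    using \<open>cellular_automaton G A \<tau>\<close> unfolding cellular_automaton_def by blast
  fix g x assume g: "g \<in> carrier G" and x: "x \<in> configs G A"
  show "\<tau> (shift G g x) = shift G g (\<tau> x)"
  proof (rule configs_eqI)
    show "\<tau> (shift G g x) \<in> configs G A" "shift G g (\<tau> x) \<in> configs G A"
      using maps g x by (auto intro!: shift_configs PiE_mem[OF maps])
    fix h assume h: "h \<in> carrier G"
    \<comment> \<open>The window of the shifted configuration at \<open>h\<close> is the window of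
      \<open>x\<close> at \<open>inv g \<otimes> h\<close>.\<close>
    have "shift G (inv h) (shift G g x) = shift G (inv (inv g \<otimes> h)) x"
      using g h by (simp add: inv_mult_group shift_mult)
    then show "\<tau> (shift G g x) h = shift G g (\<tau> x) h"
      using g h x by (simp add: \<mu> shift_configs shift_apply)
  qed
next
  assume *: "?maps \<and> ?equiv"
  then have maps: ?maps and equiv: ?equiv by blast+
  have "\<tau> x g = \<tau> (restrict (shift G (inv g) x) (carrier G)) \<one>"
    if x: "x \<in> configs G A" and g: "g \<in> carrier G" for x g
  proof -
    have "restrict (shift G (inv g) x) (carrier G) = shift G (inv g) x"
      by (simp add: shift_def)
    then show ?thesis using equiv x g by (simp add: shift_apply)
  qed
  moreover have "(\<lambda>x. \<tau> x \<one>) \<in> (carrier G \<rightarrow>\<^sub>E A) \<rightarrow> A"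
  proof
    fix x assume "x \<in> carrier G \<rightarrow>\<^sub>E A"
    then have "\<tau> x \<in> carrier G \<rightarrow>\<^sub>E A" using PiE_mem[OF maps] unfolding configs_def by blast
    then show "\<tau> x \<one> \<in> A" by auto
  qed
  ultimately show "cellular_automaton G A \<tau>"
    unfolding cellular_automaton_def
    using maps finite_G by (intro conjI exI[of _ "carrier G"] exI[of _ "\<lambda>x. \<tau> x \<one>"]) auto
qed

text \<open>The inverse of an equivariant bijection is equivariant, hence again a cellular
  automaton. Equality of the monoids lets \<open>Rank\<close> be rewritten directly.\<close>

lemma ICA_eq_Aut: "ICA G A = Aut"
proof -
  interpret A: group Aut by (rule group_Aut)
  have CA: "carrier (CA G A) = {\<tau>. cellular_automaton G A \<tau>}"
    "monoid.mult (CA G A) = compose (configs G A)" "monoid.one (CA G A) = (\<lambda>x\<in>configs G A. x)"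
    unfolding CA_def by auto
  have "Units (CA G A) = automs"
  proof
    show "Units (CA G A) \<subseteq> automs"
    proof
      fix f assume "f \<in> Units (CA G A)"
      then obtain f' where f: "cellular_automaton G A f" "cellular_automaton G A f'"
        "compose (configs G A) f' f = (\<lambda>x\<in>configs G A. x)"
        "compose (configs G A) f f' = (\<lambda>x\<in>configs G A. x)"
        unfolding Units_def CA by blast
      have mem: "f \<in> configs G A \<rightarrow> configs G A" "f' \<in> configs G A \<rightarrow> configs G A"
        using f(1,2) unfolding cellular_automaton_iff by auto
      have "f' (f x) = x" "f (f' x) = x" if "x \<in> configs G A" for x
        using fun_cong[OF f(3), of x] fun_cong[OF f(4), of x] that by (auto simp: compose_eq)
      then have "bij_betw f (configs G A) (configs G A)"
        using mem by (intro bij_betw_byWitness[where f' = f']) auto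
      then show "f \<in> automs" using f(1) unfolding automs_def cellular_automaton_iff by blast
    qed
    have CA_automs: "cellular_automaton G A f" if "f \<in> automs" for f
      using that unfolding cellular_automaton_iff automs_def by blast
    show "automs \<subseteq> Units (CA G A)"
    proof
      fix f assume f: "f \<in> automs"
      have "inv\<^bsub>Aut\<^esub> f \<in> automs" using f A.inv_closed by simp
      moreover have "compose (configs G A) (inv\<^bsub>Aut\<^esub> f) f = (\<lambda>x\<in>configs G A. x)"
        "compose (configs G A) f (inv\<^bsub>Aut\<^esub> f) = (\<lambda>x\<in>configs G A. x)"
        using f A.l_inv[of f] A.r_inv[of f] by simp_all
      ultimately show "f \<in> Units (CA G A)"
        unfolding Units_def CA using f CA_automs by blast
    qed
  qed
  then show ?thesis unfolding ICA_def units_of_def Aut_def CA by simp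
qed

section \<open>Configurations with a large stabilizer\<close>

lemma config_stab:
  assumes x: "x \<in> configs G A" and h: "h \<in> stab x" and g: "g \<in> carrier G"
  shows "x (h \<otimes> g) = x g"
proof -
  have "inv h \<in> stab x" using subgroup.m_inv_closed[OF subgroup_stab[OF x] h] .
  then have "shift G (inv h) x = x" unfolding stab_def by blast
  moreover have "h \<in> carrier G" using h unfolding stab_def by blast
  ultimately show ?thesis using g shift_apply[of g "inv h" x] by simp
qed

text \<open>Such configurations are constant, so evaluation at \<open>\<one>\<close> separates them
  and there are at most \<open>card A\<close> of them.\<close>

lemma constant_config_eq:
  assumes "x \<in> configs G A" "y \<in> configs G A" "stab x = carrier G" "stab y = carrier G"
    and "x \<one> = y \<one>"
  shows "x = y"
proof (intro configs_eqI assms(1,2))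
  fix g assume "g \<in> carrier G"
  then show "x g = y g"
    using config_stab[of x g \<one>] config_stab[of y g \<one>] assms by simp
qed

text \<open>Both configurations are constant on the two cosets of \<open>H\<close>, with distinct
  values; in a binary alphabet one value determines the other.\<close>

lemma index_2_config_eq:
  assumes A: "card A = 2" and H: "subgroup H G" "card (rcosets H) = 2"
    and x: "x \<in> configs G A" "stab x = H" and y: "y \<in> configs G A" "stab y = H"
    and eq1: "x \<one> = y \<one>"
  shows "x = y"
proof -
  have Hsub: "H \<subseteq> carrier G" using H(1) by (rule subgroup.subset)
  have "H \<noteq> carrier G" using H(2) card_rcosets_carrier[OF finite_G] by auto
  then obtain a where a: "a \<in> carrier G" "a \<notin> H" using Hsub by blast
  have HH: "H = H #> \<one>" using Hsub by (simp add: coset_mult_one)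
  have "a \<in> H #> a" using a H rcos_self by blast
  then have "H \<noteq> H #> a" using a by blast
  moreover have "H \<in> rcosets H" "H #> a \<in> rcosets H"
    using rcosetsI[OF Hsub] HH a by (metis one_closed, blast)
  ultimately have rc: "rcosets H = {H, H #> a}"
    using H(2) card_2_iff[of "rcosets H"] by auto
  have cases: "g \<in> H \<or> (\<exists>h\<in>H. g = h \<otimes> a)" if g: "g \<in> carrier G" for g
  proof -
    have "g \<in> H #> g" using g H rcos_self by blast
    moreover have "H #> g \<in> {H, H #> a}" using rcosetsI[OF Hsub g] rc by blast
    ultimately show ?thesis unfolding r_coset_def by blast
  qed
  \<comment> \<open>The disjunction stands outside the quantifiers over \<open>z\<close>, because
    the coset of \<open>g\<close> does not depend on the configuration.\<close>
  have vals: "(\<forall>z. z \<in> configs G A \<and> stab z = H \<longrightarrow> z g = z \<one>) \<or>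
      (\<forall>z. z \<in> configs G A \<and> stab z = H \<longrightarrow> z g = z a)"
    if g: "g \<in> carrier G" for g
    using cases[OF g]
  proof
    assume "g \<in> H"
    then have "z g = z \<one>" if "z \<in> configs G A" "stab z = H" for z
      using config_stab[of z g \<one>] that g by simp
    then show ?thesis by blast
  next
    assume "\<exists>h\<in>H. g = h \<otimes> a"
    then have "z g = z a" if "z \<in> configs G A" "stab z = H" for z
      using config_stab[of z _ a] that a by blast
    then show ?thesis by blast
  qed
  \<comment> \<open>Equal values on the two cosets would put \<open>a\<close> into the
    stabilizer.\<close>
  have ne: "z \<one> \<noteq> z a" if z: "z \<in> configs G A" "stab z = H" for z
  proof
    assume "z \<one> = z a"
    then have "z g = z a" if "g \<in> carrier G" for g using vals[OF that] z by metis
    then have "shift G a z = z" by (intro shift_constant[OF z(1) _ a(1)]) metis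
    then have "a \<in> stab z" using a unfolding stab_def by blast
    then show False using a z by simp
  qed
  have "x \<one> \<in> A" "x a \<in> A" "y a \<in> A"
    using config_val[OF x(1) one_closed] config_val[OF x(1) a(1)] config_val[OF y(1) a(1)] .
  then have "x a = y a"
    using ne[OF x] ne[OF y] eq1 by (intro card_2_other_unique[OF A, of _ _ "x \<one>"]) simp_all
  then have "x g = y g" if "g \<in> carrier G" for g using vals[OF that] x y eq1 by metis
  then show ?thesis using x y by (intro configs_eqI)
qed

text \<open>Some shift of \<open>x\<close> agrees with \<open>y\<close> at \<open>\<one>\<close>,
  and therefore everywhere.\<close>

lemma index_2_transitive:
  assumes A: "card A = 2" and H: "subgroup H G" "card (rcosets H) = 2"
    and x: "x \<in> configs G A" "stab x = H" and y: "y \<in> configs G A" "stab y = H"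
  shows "y \<in> orb x"
proof (cases "\<exists>g\<in>carrier G. x g = y \<one>")
  case True
  then obtain g where g: "g \<in> carrier G" "x g = y \<one>" by blast
  have "shift G (inv g) x \<one> = y \<one>" using g by (simp add: shift_apply)
  moreover have "stab (shift G (inv g) x) = H" using g x by simp
  ultimately have "shift G (inv g) x = y"
    using g x y by (intro index_2_config_eq[OF A H]) (auto simp: shift_configs)
  then show ?thesis using g orb_actI[of "inv g" x] by simp
next
  \<comment> \<open>If \<open>x\<close> missed the value \<open>y \<one>\<close>, it would be
    constant, and its stabilizer would have index 1.\<close>
  case False
  have val: "x g \<in> A" "y g \<in> A" if "g \<in> carrier G" for g
    using config_val[OF x(1) that] config_val[OF y(1) that] .
  have "x g = x h" if "g \<in> carrier G" "h \<in> carrier G" for g h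
    using False that val one_closed by (intro card_2_other_unique[OF A, of _ _ "y \<one>"]) blast+
  then have "shift G g x = x" if "g \<in> carrier G" for g
    by (rule shift_constant[OF x(1) _ that])
  then have "H = carrier G" using x(2) unfolding stab_def by blast
  then show ?thesis using H(2) card_rcosets_carrier[OF finite_G] by simp
qed

text \<open>The number of generators allotted to the block with stabilizer \<open>H\<close>: a
  cycle, a transposition, and \<open>Rank G\<close> rotations unless the index of \<open>H\<close>
  is 1 or prime. The value 1 marks the savings over a binary alphabet.\<close>

definition block_bound :: "'a set \<Rightarrow> nat" where
  "block_bound H =
    (if H = carrier G then if card A = 2 then 1 else 2
     else if Factorial_Ring.prime (card (rcosets H))
       then if card A = 2 \<and> card (rcosets H) = 2 then 1 else 2
     else Rank G + 2)"

text \<open>The representatives \<open>R\<close> are exposed along with \<open>T\<close>, so that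
  all blocks together meet the hypotheses of \<open>automs_generated_by_exch\<close>.\<close>

lemma block_generators_bounded:
  assumes H: "subgroup H G"
  shows "\<exists>T R. T \<subseteq> automs \<and> finite T \<and> card T \<le> block_bound H \<and> R \<subseteq> configs G A \<and>
    (\<forall>y\<in>configs G A. stab y = H \<longrightarrow> (\<exists>x\<in>R. y \<in> orb x)) \<and>
    (\<forall>N. subgroup N Aut \<longrightarrow> T \<subseteq> N \<longrightarrow>
      (\<forall>x\<in>R. \<forall>y\<in>configs G A. stab x = stab y \<longrightarrow> exch x y \<in> N))"
proof -
  obtain n :: nat and x where
    reps: "\<forall>i<n. x i \<in> configs G A \<and> stab (x i) = H"
      "\<forall>i<n. \<forall>j<n. i \<noteq> j \<longrightarrow> x j \<notin> orb (x i)"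
      "\<forall>y\<in>configs G A. stab y = H \<longrightarrow> (\<exists>j<n. y \<in> orb (x j))"
    using block_representatives[of H] by (elim exE conjE) (rule that)
  have x: "\<And>i. i < n \<Longrightarrow> x i \<in> configs G A" "\<And>i. i < n \<Longrightarrow> stab (x i) = H"
    and disj: "\<And>i j. \<lbrakk>i < n; j < n; i \<noteq> j\<rbrakk> \<Longrightarrow> x j \<notin> orb (x i)"
    and cover: "\<And>y. \<lbrakk>y \<in> configs G A; stab y = H\<rbrakk> \<Longrightarrow> \<exists>j<n. y \<in> orb (x j)"
    using reps by (blast, blast, blast, blast)
  have "\<exists>k D. k \<in> carrier G \<and> D \<subseteq> carrier G \<and> finite D \<and>
    (\<forall>K. submonoid K G \<longrightarrow> H \<subseteq> K \<longrightarrow> insert k D \<subseteq> K \<longrightarrow> carrier G \<subseteq> K) \<and>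
    card D + (if n \<le> 1 \<or> n = 2 \<and> k \<in> H then 1 else 2) \<le> block_bound H"
  proof -
    consider (whole) "H = carrier G" | (prime) "H \<noteq> carrier G" "Factorial_Ring.prime (card (rcosets H))"
      | (other) "H \<noteq> carrier G" "\<not> Factorial_Ring.prime (card (rcosets H))" by blast
    then show ?thesis
    proof cases
      case whole
      \<comment> \<open>There are at most \<open>card A\<close> orbits, and
        \<open>k = \<one>\<close> lies in \<open>H\<close>; so over a binary alphabet one generator
        suffices.\<close>
      have "inj_on (\<lambda>i. x i \<one>) {..<n}"
      proof (rule inj_onI)
        fix i j assume ij: "i \<in> {..<n}" "j \<in> {..<n}" "x i \<one> = x j \<one>"
        then have "x i = x j" using x whole by (intro constant_config_eq) auto
        then show "i = j" using disj[of i j] ij orb_self[of "x j"] x by fastforce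
      qed
      moreover have "(\<lambda>i. x i \<one>) ` {..<n} \<subseteq> A"
        using config_val[OF x(1) one_closed] by auto
      ultimately have "n \<le> card A" using card_inj_on_le finite_A by fastforce
      then show ?thesis using whole
        by (intro exI[of _ \<one>] exI[of _ "{}"]) (auto simp: block_bound_def)
    next
      case prime
      then obtain k where k: "k \<in> carrier G" "k \<notin> H" using subgroup.subset[OF H] by blast
      have "carrier G \<subseteq> K" if K: "submonoid K G" "H \<subseteq> K" "insert k {} \<subseteq> K" for K
        using prime_index_maximal[OF finite_G H finite_submonoid_is_subgroup[OF finite_G K(1)] prime(2)]
          K(2,3) k by blast
      moreover have "n \<le> 1" if "card A = 2" "card (rcosets H) = 2"
      proof (rule ccontr)
        assume "\<not> n \<le> 1"
        then have "x 1 \<in> orb (x 0)" using x by (intro index_2_transitive[OF that(1) H that(2)]) auto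
        then show False using disj[of 0 1] \<open>\<not> n \<le> 1\<close> by auto
      qed
      ultimately show ?thesis using prime k
        by (intro exI[of _ k] exI[of _ "{}"]) (auto simp: block_bound_def)
    next
      case other
      \<comment> \<open>A minimal generating set of \<open>G\<close> supplies the rotations, and
        \<open>k = \<one>\<close> leaves the cycle untwisted.\<close>
      obtain D where D: "D \<subseteq> carrier G" "finite D" "card D = Rank G"
        "\<forall>N. submonoid N G \<longrightarrow> D \<subseteq> N \<longrightarrow> carrier G \<subseteq> N"
        using Rank_attained[OF is_monoid finite_G] by blast
      then show ?thesis using other
        by (intro exI[of _ \<one>] exI[of _ D]) (auto simp: block_bound_def)
    qed
  qed
  then obtain k D where kD: "k \<in> carrier G" "D \<subseteq> carrier G" "finite D"
    "\<And>K. submonoid K G \<Longrightarrow> H \<subseteq> K \<Longrightarrow> insert k D \<subseteq> K \<Longrightarrow> carrier G \<subseteq> K"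
    "card D + (if n \<le> 1 \<or> n = 2 \<and> k \<in> H then 1 else 2) \<le> block_bound H"
    by blast
  obtain T where T: "T \<subseteq> automs" "finite T"
    "card T \<le> card D + (if n \<le> 1 \<or> n = 2 \<and> k \<in> H then 1 else 2)"
    "\<And>N i y. \<lbrakk>subgroup N Aut; T \<subseteq> N; i < n; y \<in> configs G A; stab y = H\<rbrakk> \<Longrightarrow> exch (x i) y \<in> N"
    using block_generators[OF x disj cover kD(1-4)] by blast
  show ?thesis
  proof (intro exI[of _ T] exI[of _ "x ` {..<n}"] conjI ballI allI impI)
    show "card T \<le> block_bound H" using T(3) kD(5) by linarith
    show "\<exists>x\<in>x ` {..<n}. y \<in> orb x" if "y \<in> configs G A" "stab y = H" for y
      using cover[OF that] by blast
  qed (use T x cover in auto)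
qed

section \<open>Assembling the blocks of all subgroups\<close>

lemma finite_subgroups: "finite {H. subgroup H G}"
  by (rule finite_subset[of _ "Pow (carrier G)"]) (use finite_G subgroup.subset in auto)

text \<open>The union of the generating sets of the blocks generates everything, since each
  configuration lies in the block of its stabilizer.\<close>

lemma Rank_ICA_le: "Rank (ICA G A) \<le> (\<Sum>H | subgroup H G. block_bound H)"
proof -
  interpret A: group Aut by (rule group_Aut)
  define S where "S = {H. subgroup H G}"
  have finS: "finite S" unfolding S_def by (rule finite_subgroups)
  have "\<forall>H\<in>S. \<exists>T R. T \<subseteq> automs \<and> finite T \<and> card T \<le> block_bound H \<and> R \<subseteq> configs G A \<and>
    (\<forall>y\<in>configs G A. stab y = H \<longrightarrow> (\<exists>x\<in>R. y \<in> orb x)) \<and>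
    (\<forall>N. subgroup N Aut \<longrightarrow> T \<subseteq> N \<longrightarrow>
      (\<forall>x\<in>R. \<forall>y\<in>configs G A. stab x = stab y \<longrightarrow> exch x y \<in> N))"
    using block_generators_bounded unfolding S_def by blast
  from bchoice[OF this] obtain T where "\<forall>H\<in>S. \<exists>R. T H \<subseteq> automs \<and> finite (T H) \<and>
    card (T H) \<le> block_bound H \<and> R \<subseteq> configs G A \<and>
    (\<forall>y\<in>configs G A. stab y = H \<longrightarrow> (\<exists>x\<in>R. y \<in> orb x)) \<and>
    (\<forall>N. subgroup N Aut \<longrightarrow> T H \<subseteq> N \<longrightarrow>
      (\<forall>x\<in>R. \<forall>y\<in>configs G A. stab x = stab y \<longrightarrow> exch x y \<in> N))" ..
  from bchoice[OF this] obtain R where TR: "\<forall>H\<in>S. T H \<subseteq> automs \<and> finite (T H) \<and>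
    card (T H) \<le> block_bound H \<and> R H \<subseteq> configs G A \<and>
    (\<forall>y\<in>configs G A. stab y = H \<longrightarrow> (\<exists>x\<in>R H. y \<in> orb x)) \<and>
    (\<forall>N. subgroup N Aut \<longrightarrow> T H \<subseteq> N \<longrightarrow>
      (\<forall>x\<in>R H. \<forall>y\<in>configs G A. stab x = stab y \<longrightarrow> exch x y \<in> N))" ..
  have T: "T H \<subseteq> automs" "finite (T H)" "card (T H) \<le> block_bound H" "R H \<subseteq> configs G A"
    if "H \<in> S" for H
  proof -
    note c = bspec[OF TR that]
    show "T H \<subseteq> automs" "finite (T H)" "card (T H) \<le> block_bound H" "R H \<subseteq> configs G A"
      using conjunct1[OF c] conjunct1[OF conjunct2[OF c]] conjunct1[OF conjunct2[OF conjunct2[OF c]]]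
        conjunct1[OF conjunct2[OF conjunct2[OF conjunct2[OF c]]]] .
  qed
  have R: "\<forall>y\<in>configs G A. stab y = H \<longrightarrow> (\<exists>x\<in>R H. y \<in> orb x)" if "H \<in> S" for H
    using bspec[OF TR that] by (elim conjE)
  have gen: "\<forall>N. subgroup N Aut \<longrightarrow> T H \<subseteq> N \<longrightarrow>
      (\<forall>x\<in>R H. \<forall>y\<in>configs G A. stab x = stab y \<longrightarrow> exch x y \<in> N)" if "H \<in> S" for H
    using bspec[OF TR that] by (elim conjE)
  have "Rank Aut \<le> card (\<Union>H\<in>S. T H)"
  proof (rule Rank_le[OF A.is_monoid])
    fix N assume N: "submonoid N Aut" "(\<Union>H\<in>S. T H) \<subseteq> N"
    then have sub: "subgroup N Aut"
      using A.finite_submonoid_is_subgroup finite_automs by simp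
    have "automs \<subseteq> N"
    proof (rule automs_generated_by_exch[OF sub, of "\<Union>H\<in>S. R H"])
      fix z assume z: "z \<in> configs G A"
      then have S: "stab z \<in> S" unfolding S_def using subgroup_stab by blast
      then obtain x where "x \<in> R (stab z)" "z \<in> orb x" using R[OF S] z by blast
      then show "\<exists>x\<in>\<Union>H\<in>S. R H. z \<in> orb x" using S by blast
    next
      fix x y assume "x \<in> (\<Union>H\<in>S. R H)" and y: "y \<in> configs G A" "stab x = stab y"
      then obtain H where H: "H \<in> S" "x \<in> R H" by blast
      then have "T H \<subseteq> N" using N(2) by blast
      then show "exch x y \<in> N" using gen[OF H(1)] sub H(2) y by simp
    next
      show "(\<Union>H\<in>S. R H) \<subseteq> configs G A" using T(4) by blast
    qed
    then show "carrier Aut \<subseteq> N" by simp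
  qed (use T(1,2) finS in \<open>auto simp: subset_iff\<close>)
  also have "\<dots> \<le> (\<Sum>H\<in>S. card (T H))" by (rule card_UN_le[OF finS])
  also have "\<dots> \<le> (\<Sum>H\<in>S. block_bound H)" using T(3) by (rule sum_mono)
  finally show ?thesis unfolding ICA_eq_Aut S_def .
qed

end

text \<open>Integers keep the subtractions from being truncated. The bounds are summed separately
  over \<open>G\<close> itself, the subgroups of prime index and the others.\<close>

theorem theorem3:
  fixes G :: "('g, 'm) monoid_scheme" and A :: "'a set" and q r r_P :: nat and r_i :: "nat \<Rightarrow> nat"
  assumes "dedekind_group G" and "finite (carrier G)"
    and "finite A" and "card A = q" and "q \<ge> 2"
    and "r = subgroup_classes G" and "\<And>i. r_i i = subgroup_classes_index G i"
    and "r_P = (\<Sum>p\<in>prime_factors (order G). r_i p)"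
  shows "int (Rank (ICA G A)) \<le>
    (if q = 2
     then (int r - int r_P - 1) * int (Rank G) + 2 * int r - int (r_i 2) - 1
     else (int r - int r_P - 1) * int (Rank G) + 2 * int r)"
proof -
  interpret group G using assms(1) unfolding dedekind_group_def by blast
  interpret dedekind_shift G A by unfold_locales (use assms in auto)
  define S where "S = {H. subgroup H G}"
  define P where "P = {H \<in> S. Factorial_Ring.prime (card (rcosets\<^bsub>G\<^esub> H))}"
  define P2 where "P2 = {H \<in> S. card (rcosets\<^bsub>G\<^esub> H) = 2}"
  have finS: "finite S" unfolding S_def by (rule finite_subgroups)
  have finP: "finite P" using finS unfolding P_def by simp
  have r: "r = card S"
    unfolding assms(6) subgroup_classes_def S_def
    by (rule subgroup_classes_dedekind[OF assms(1)]) blast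
  have ri: "r_i i = card {H \<in> S. card (rcosets\<^bsub>G\<^esub> H) = i}" for i
    unfolding assms(7) subgroup_classes_index_def S_def
    using subgroup_classes_dedekind[OF assms(1), of "{H. subgroup H G \<and> card (rcosets\<^bsub>G\<^esub> H) = i}"]
    by simp
  have ord: "order G > 0" using assms(2) order_gt_0_iff_finite by blast
  \<comment> \<open>An index divides \<open>order G\<close>, so a prime index is one of its prime
    factors.\<close>
  have "P = (\<Union>p\<in>prime_factors (order G). {H \<in> S. card (rcosets\<^bsub>G\<^esub> H) = p})"
  proof -
    have "card (rcosets\<^bsub>G\<^esub> H) dvd order G" if "H \<in> S" for H
      using lagrange[of H] that unfolding S_def by (metis dvd_triv_left mem_Collect_eq)
    then show ?thesis unfolding P_def using ord by (auto simp: prime_factors_dvd)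
  qed
  then have rP: "r_P = card P"
    unfolding assms(8) ri using finS by (simp add: card_UN_disjoint disjoint_iff)
  have GS: "carrier G \<in> S" unfolding S_def using subgroup_self by blast
  have GP: "carrier G \<notin> P" using card_rcosets_carrier[OF assms(2)] unfolding P_def by auto
  \<comment> \<open>These are the proper subgroups of nonprime index, the only ones charged with
    \<open>Rank G\<close>.\<close>
  define Q where "Q = S - insert (carrier G) P"
  have PS: "insert (carrier G) P \<subseteq> S" using GS unfolding P_def by blast
  then have "card (insert (carrier G) P) + card Q = card S"
    unfolding Q_def using finS by (metis add.commute card_Diff_subset card_mono finite_subset le_add_diff_inverse2)
  then have cQ: "int (card Q) = int r - int r_P - 1" using GP finP r rP by simp
  have P2P: "P2 \<subseteq> P" unfolding P2_def P_def by auto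
  have "(\<Sum>H\<in>S. int (block_bound H)) =
      (\<Sum>H\<in>insert (carrier G) P. int (block_bound H)) + (\<Sum>H\<in>Q. int (block_bound H))"
    unfolding Q_def using sum.subset_diff[OF PS finS] by (simp add: add.commute)
  also have "(\<Sum>H\<in>Q. int (block_bound H)) = int (card Q) * (int (Rank G) + 2)"
  proof -
    have "(\<Sum>H\<in>Q. int (block_bound H)) = (\<Sum>H\<in>Q. int (Rank G) + 2)"
      by (rule sum.cong) (auto simp: Q_def P_def block_bound_def)
    then show ?thesis by simp
  qed
  also have "(\<Sum>H\<in>insert (carrier G) P. int (block_bound H)) =
      int (block_bound (carrier G)) + (\<Sum>H\<in>P. int (block_bound H))"
    using finP GP by simp
  also have "(\<Sum>H\<in>P. int (block_bound H)) = 2 * int r_P - (if q = 2 then int (r_i 2) else 0)"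
  proof -
    \<comment> \<open>Each subgroup in \<open>P\<close> costs 2, less 1 if its index is 2 and the
      alphabet is binary.\<close>
    have "(\<Sum>H\<in>P. int (block_bound H)) = (\<Sum>H\<in>P. 2 - (if q = 2 \<and> H \<in> P2 then 1 else 0))"
      using GP assms(4) by (intro sum.cong) (auto simp: P_def P2_def block_bound_def)
    also have "\<dots> = 2 * int r_P - (\<Sum>H\<in>P. if q = 2 \<and> H \<in> P2 then 1 else 0)"
      unfolding sum_subtractf rP by simp
    also have "(\<Sum>H\<in>P. if q = 2 \<and> H \<in> P2 then 1 else (0::int)) = (if q = 2 then int (r_i 2) else 0)"
      using finP P2P by (simp add: ri P2_def[symmetric] Int_absorb1 flip: sum.inter_restrict)
    finally show ?thesis .
  qed
  also have "int (block_bound (carrier G)) = (if q = 2 then 1 else 2)"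
    using assms(4) by (simp add: block_bound_def)
  finally have "(\<Sum>H\<in>S. int (block_bound H)) = (if q = 2 then 1 else 2) +
      (2 * int r_P - (if q = 2 then int (r_i 2) else 0)) + (int r - int r_P - 1) * (int (Rank G) + 2)"
    unfolding cQ .
  moreover have "int (Rank (ICA G A)) \<le> (\<Sum>H\<in>S. int (block_bound H))"
    using Rank_ICA_le unfolding S_def by (metis of_nat_le_iff of_nat_sum)
  \<comment> \<open>The charges of 2 per subgroup add up to \<open>2 * r\<close>; for
    \<open>q = 2\<close>, \<open>G\<close> and each subgroup of index 2 save one.\<close>
  ultimately show ?thesis by (cases "q = 2") (simp_all add: algebra_simps)
qed

end
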